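(* Let $A$ be a finite set, let $(B;+)$ be a finite Boolean group, let $n \ge 1$ and $t \ge 0$ be integers with $n - |A| = 2t + 1 > 0$, and let $f \colon A^n \to B$. Then $f$ is determined by $\operatorname{oddsupp}$ if and only if there is a map $\varphi \colon \mathcal{P}'_n(A) \to B$ such that for all $\mathbf{x} \in A^n$ \[ f(\mathbf{x}) = \sum_{i = t + 1}^{\lfloor n/2 \rfloor} \sum_{\substack{I \subseteq [n] \\ |I| = n - 2i}} \binom{i - 1}{t} \varphi(\operatorname{oddsupp}(\mathbf{x}|_I)). \] Moreover, such a $\varphi$ is uniquely determined by $f$.
   Context: A Boolean group is an abelian group in which $b + b = 0$ for all $b$; an integer coefficient $m$ times an element $b$ means $b + \dots + b$ ($m$ times), so it equals $b$ if $m$ is odd and $0$ if $m$ is even. $[n] = \{1,\dots,n\}$. For $\mathbf{x} \in A^n$ and $I = \{i_1 < \dots < i_k\} \subseteq [n]$, $\mathbf{x}|_I = (x_{i_1}, \dots, x_{i_k})$ (the empty tuple if $I = \emptyset$). For a tuple $(a_1,\dots,a_m)$ over $A$ ($m \ge 0$), $\operatorname{oddsupp}(a_1,\dots,a_m) = \{a \in A : |\{j : a_j = a\}| \text{ is odd}\}$ (so $\operatorname{oddsupp}$ of the empty tuple is $\emptyset$). $\mathcal{P}'_n(A)$ is the set of subsets $S \subseteq A$ with $|S| \in \{n, n-2, n-4, \dots\}$. A function $f \colon A^n \to B$ is determined by $\operatorname{oddsupp}$ if there is a map $\psi \colon \mathcal{P}(A) \to B$ with $f(\mathbf{x}) = \psi(\operatorname{oddsupp}(\mathbf{x}))$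 for all $\mathbf{x} \in A^n$. *)

theory Defs
  imports Main
begin

text \<open>
  Tuples over \<open>A\<close> are lists, so positions are numbered \<open>0, \<dots>, n - 1\<close> instead of \<open>1, \<dots>, n\<close>;
  for \<open>I \<subseteq> {..<n}\<close> the restriction of \<open>x\<close> to \<open>I\<close> is \<^const>\<open>nths\<close> applied to \<open>x\<close> and \<open>I\<close>.
\<close>

definition tuples :: "nat \<Rightarrow> 'a set \<Rightarrow> 'a list set" where
  "tuples n A = {x. length x = n \<and> set x \<subseteq> A}"

text \<open>For a tuple over \<open>A\<close> this is automatically a subset of \<open>A\<close>.\<close>

definition oddsupp :: "'a list \<Rightarrow> 'a set" where
  "oddsupp x = {a. odd (card {j. j < length x \<and> x ! j = a})}"

text \<open>The subsets of \<open>A\<close> whose cardinality is one of \<open>n, n - 2, n - 4, \<dots>\<close> (for finite \<open>A\<close>).\<close>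

definition Pow' :: "nat \<Rightarrow> 'a set \<Rightarrow> 'a set set" where
  "Pow' n A = {S. S \<subseteq> A \<and> (\<exists>k. card S + 2 * k = n)}"

text \<open>
  Maps with domain \<open>A\<^sup>n\<close>, the power set of \<open>A\<close> or \<open>Pow' n A\<close> are total functions of which only the
  values on that domain matter.
\<close>

definition determined_by_oddsupp :: "nat \<Rightarrow> 'a set \<Rightarrow> ('a list \<Rightarrow> 'b) \<Rightarrow> bool" where
  "determined_by_oddsupp n A f \<longleftrightarrow> (\<exists>\<psi>. \<forall>x\<in>tuples n A. f x = \<psi> (oddsupp x))"

definition nat_multiple :: "nat \<Rightarrow> 'b::comm_monoid_add \<Rightarrow> 'b" where
  "nat_multiple m b = (\<Sum>_<m. b)"

definition oddsupp_representation ::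
  "nat \<Rightarrow> nat \<Rightarrow> 'a set \<Rightarrow> ('a list \<Rightarrow> 'b::comm_monoid_add) \<Rightarrow> ('a set \<Rightarrow> 'b) \<Rightarrow> bool" where
  "oddsupp_representation n t A f \<phi> \<longleftrightarrow>
     (\<forall>x\<in>tuples n A.
        f x = (\<Sum>i = t + 1..n div 2. \<Sum>I | I \<subseteq> {..<n} \<and> card I = n - 2 * i.
                 nat_multiple ((i - 1) choose t) (\<phi> (oddsupp (nths x I)))))"

end

(*
  For a fixed tuple x, count modulo 2 the index sets I of size k with oddsupp (x|I) = T. With
  S = oddsupp x, the parity is that of binom ((n - |S|) / 2) ((k - |T|) / 2) if T is a subset
  of S and k - |T| is even and nonnegative, and the count is even otherwise. Hence the
  representation is a linear system in phi that is triangular with respect to inclusion. Its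
  diagonal coefficient at S is, modulo 2, the sum over i >= 1 of binom (i - 1) t * binom N i with
  N = (n - |S|) / 2 > t. For N = t + 1 this sum is 1, and passing from N to N + 1 adds
  the sum over j of binom j t * binom N j, that is, binom N t * 2^(N - t), which is even.
  A triangular system with odd diagonal over a Boolean group is uniquely solvable.
*)
theory Submission
  imports Defs
begin

section \<open>Odd supports of tuples\<close>

definition toggle :: "'a \<Rightarrow> 'a set \<Rightarrow> 'a set" where
  "toggle a T = (if a \<in> T then T - {a} else insert a T)"

lemma toggle_toggle [simp]: "toggle a (toggle a T) = T"
  by (auto simp: toggle_def)

lemma toggle_eq_iff: "toggle a S = T \<longleftrightarrow> S = toggle a T"
  by (metis toggle_toggle)

lemma oddsupp_conv_count_list: "oddsupp x = {a. odd (count_list x a)}"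
  by (simp add: oddsupp_def count_list_eq_length_filter length_filter_conv_card eq_commute)

lemma oddsupp_Nil [simp]: "oddsupp [] = {}"
  by (simp add: oddsupp_conv_count_list)

lemma oddsupp_Cons [simp]: "oddsupp (a # y) = toggle a (oddsupp y)"
  by (auto simp: oddsupp_conv_count_list toggle_def)

lemma finite_oddsupp [simp]: "finite (oddsupp x)"
  by (induction x) (auto simp: toggle_def)

lemma oddsupp_subset: "oddsupp x \<subseteq> set x"
  by (induction x) (auto simp: toggle_def)

lemma card_oddsupp: "\<exists>k. card (oddsupp x) + 2 * k = length x"
proof (induction x)
  case (Cons a y)
  then obtain k where k: "card (oddsupp y) + 2 * k = length y" by blast
  show ?case
  proof (cases "a \<in> oddsupp y")
    case True
    then have "card (oddsupp y) > 0" by (auto simp: card_gt_0_iff)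
    with True k have "card (oddsupp (a # y)) + 2 * (k + 1) = length (a # y)"
      by (simp add: toggle_def)
    then show ?thesis by blast
  next
    case False
    with k have "card (oddsupp (a # y)) + 2 * k = length (a # y)"
      by (simp add: toggle_def)
    then show ?thesis by blast
  qed
qed simp

lemma oddsupp_in_Pow':
  assumes "x \<in> tuples n A"
  shows "oddsupp x \<in> Pow' n A"
  using assms oddsupp_subset[of x] card_oddsupp[of x] by (auto simp: tuples_def Pow'_def)

lemma oddsupp_nths_subset: "oddsupp (nths x I) \<subseteq> set x"
  using oddsupp_subset[of "nths x I"] set_nths_subset[of x I] by blast

lemma oddsupp_replicate_append: "oddsupp (replicate (2 * k) a @ y) = oddsupp y"
  by (induction k) simp_all

lemma oddsupp_distinct: "distinct x \<Longrightarrow> oddsupp x = set x"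
  by (induction x) (auto simp: toggle_def)

text \<open>An enumeration of \<open>S\<close> without repetition is padded to length
  \<open>n\<close> by an even number of copies of one letter, which leave the odd support
  unchanged.\<close>

lemma exists_tuple_with_oddsupp:
  assumes "finite A" "A \<noteq> {}" "S \<in> Pow' n A"
  obtains x where "x \<in> tuples n A" "oddsupp x = S"
proof -
  from assms obtain k where S: "S \<subseteq> A" "card S + 2 * k = n" by (auto simp: Pow'_def)
  from S(1) assms(1) have "finite S" by (rule finite_subset)
  then obtain y where y: "set y = S" "distinct y" using finite_distinct_list by blast
  from assms(2) obtain a where a: "a \<in> A" by blast
  show thesis
  proof
    show "replicate (2 * k) a @ y \<in> tuples n A"
      using S y a distinct_card[OF y(2)] by (auto simp: tuples_def)
    show "oddsupp (replicate (2 * k) a @ y) = S"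
      using oddsupp_distinct[OF y(2)] y(1) by (simp add: oddsupp_replicate_append)
  qed
qed

section \<open>Counting index sets by size and restricted odd support\<close>

definition restr_sets :: "'a list \<Rightarrow> nat \<Rightarrow> 'a set \<Rightarrow> nat set set" where
  "restr_sets x k T = {I. I \<subseteq> {..<length x} \<and> card I = k \<and> oddsupp (nths x I) = T}"

lemma finite_restr_sets [simp]: "finite (restr_sets x k T)"
  by (rule finite_subset[of _ "Pow {..<length x}"]) (auto simp: restr_sets_def)

text \<open>Either 0 is not in \<open>I\<close>, or removing it leaves an index set of the tail with
  odd support \<open>toggle a T\<close>, toggling being an involution. The case \<open>k = 0\<close>
  is separate because \<open>k - 1\<close> would truncate.\<close>

lemma restr_sets_Cons:
  "restr_sets (a # y) k T = image Suc ` restr_sets y k T \<union>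
     (if k = 0 then {} else (\<lambda>J. insert 0 (Suc ` J)) ` restr_sets y (k - 1) (toggle a T))"
  (is "?L = ?R")
proof (intro set_eqI)
  fix I :: "nat set"
  define J where "J = {j. Suc j \<in> I}"
  have I: "I = (if 0 \<in> I then insert 0 (Suc ` J) else Suc ` J)"
  proof (intro set_eqI)
    fix i show "i \<in> I \<longleftrightarrow> i \<in> (if 0 \<in> I then insert 0 (Suc ` J) else Suc ` J)"
      by (cases i) (auto simp: J_def)
  qed
  have sub: "I \<subseteq> {..<length (a # y)} \<longleftrightarrow> J \<subseteq> {..<length y}"
    by (subst I) auto
  have I0: "I = insert 0 (Suc ` J)" if "0 \<in> I" using I that by simp
  have I1: "I = Suc ` J" if "0 \<notin> I" using I that by simp
  have im: "I \<in> image Suc ` X \<longleftrightarrow> 0 \<notin> I \<and> J \<in> X" for X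
  proof
    assume "I \<in> image Suc ` X"
    then obtain K where "K \<in> X" "I = Suc ` K" by blast
    moreover from this have "J = K" by (auto simp: J_def)
    ultimately show "0 \<notin> I \<and> J \<in> X" by simp
  qed (use I1 in blast)
  have im0: "I \<in> (\<lambda>J. insert 0 (Suc ` J)) ` X \<longleftrightarrow> 0 \<in> I \<and> J \<in> X" for X
  proof
    assume "I \<in> (\<lambda>J. insert 0 (Suc ` J)) ` X"
    then obtain K where "K \<in> X" "I = insert 0 (Suc ` K)" by blast
    moreover from this have "J = K" by (auto simp: J_def)
    ultimately show "0 \<in> I \<and> J \<in> X" by simp
  qed (use I0 in blast)
  have nths: "nths (a # y) I = (if 0 \<in> I then [a] else []) @ nths y J"
    by (simp add: nths_Cons J_def)
  have card: "card I = (if 0 \<in> I then Suc (card J) else card J)" if "J \<subseteq> {..<length y}"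
  proof -
    have "finite J" using that finite_subset by blast
    then show ?thesis by (subst I) (auto simp: card_image)
  qed
  show "I \<in> ?L \<longleftrightarrow> I \<in> ?R"
  proof (cases "J \<subseteq> {..<length y}")
    case True
    then show ?thesis
      using sub card[OF True] nths
      by (cases "0 \<in> I") (auto simp: im im0 restr_sets_def toggle_eq_iff)
  next
    case False
    then show ?thesis using sub by (simp add: im im0 restr_sets_def)
  qed
qed

lemma card_restr_sets_Cons:
  "card (restr_sets (a # y) k T) =
     card (restr_sets y k T) + (if k = 0 then 0 else card (restr_sets y (k - 1) (toggle a T)))"
proof -
  have 1: "inj_on (image Suc) X" for X
    by (rule inj_onI) (simp add: inj_image_eq_iff)
  have 2: "inj_on (\<lambda>J. insert 0 (Suc ` J)) X" for X
  proof (rule inj_onI)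
    fix J K :: "nat set"
    assume "insert 0 (Suc ` J) = insert 0 (Suc ` K)"
    then have "Suc ` J = Suc ` K" by (metis Diff_insert_absorb image_iff Suc_not_Zero)
    then show "J = K" by (simp add: inj_image_eq_iff)
  qed
  have 3: "image Suc ` X \<inter> (\<lambda>J. insert 0 (Suc ` J)) ` Y = {}" for X Y
    by auto
  show ?thesis
    by (auto simp: restr_sets_Cons card_Un_disjoint card_image 1 2 3)
qed

text \<open>This is the coefficient of \<open>z^k\<close> in
  \<open>z^m * (1 + z^2)^N\<close>.\<close>

definition half_binom :: "nat \<Rightarrow> nat \<Rightarrow> nat \<Rightarrow> nat" where
  "half_binom N k m = (if m \<le> k \<and> even (k - m) then N choose ((k - m) div 2) else 0)"

lemma half_binom_Suc_Suc: "half_binom N (Suc k) (Suc m) = half_binom N k m"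
  unfolding half_binom_def diff_Suc_Suc Suc_le_mono ..

lemma half_binom_0_Suc: "half_binom N 0 (Suc m) = 0"
  by (simp add: half_binom_def)

text \<open>Coefficientwise, this multiplies by \<open>1 + z^2\<close>; the factor
  \<open>z^2\<close> is split into one shift of \<open>k\<close> and one of
  \<open>m\<close>.\<close>

lemma half_binom_Pascal:
  "half_binom (Suc N) k m = half_binom N k m + (if k = 0 then 0 else half_binom N (k - 1) (Suc m))"
proof (cases "m \<le> k \<and> even (k - m)")
  case True
  then obtain j where "k = m + 2 * j" by (metis evenE le_add_diff_inverse)
  then show ?thesis by (cases j) (auto simp: half_binom_def)
next
  case False
  then have "\<not> (Suc m \<le> k - 1 \<and> even (k - 1 - Suc m))" by auto
  with False show ?thesis unfolding half_binom_def by (simp only: if_False) simp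
qed

text \<open>
  The generating function in \<open>z\<close> of the sizes of the subsets \<open>I\<close> with restricted support \<open>T\<close> is
  the product over the letters \<open>a\<close> of the odd or even part of \<open>(1 + z)\<^sup>m\<close>, where \<open>m\<close> is the
  multiplicity of \<open>a\<close>. Modulo 2 these parts are \<open>z (1 + z\<^sup>2)\<^sup>j\<close> (or 0, if \<open>m\<close> is even) and
  \<open>(1 + z\<^sup>2)\<^sup>j\<close> for \<open>j = m div 2\<close>.
\<close>

lemma odd_card_restr_sets:
  "odd (card (restr_sets x k T)) \<longleftrightarrow>
     T \<subseteq> oddsupp x \<and> odd (half_binom ((length x - card (oddsupp x)) div 2) k (card T))"
proof (induction x arbitrary: k T)
  case Nil
  have "restr_sets [] k T = (if k = 0 \<and> T = {} then {{}} else {})"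
    by (auto simp: restr_sets_def)
  then show ?case by (cases "k div 2") (auto simp: half_binom_def)
next
  case (Cons a y)
  define S where "S = oddsupp y"
  define N where "N = (length y - card S) div 2"
  have finS: "finite S" by (simp add: S_def)
  have IH: "odd (card (restr_sets y k T)) \<longleftrightarrow> T \<subseteq> S \<and> odd (half_binom N k (card T))" for k T
    using Cons.IH by (simp add: S_def N_def)
  \<comment> \<open>Inequality of truth values serves as addition modulo 2.\<close>
  have "odd (card (restr_sets (a # y) k T)) \<longleftrightarrow>
      odd (card (restr_sets y k T)) \<noteq> (k \<noteq> 0 \<and> odd (card (restr_sets y (k - 1) (toggle a T))))"
    by (auto simp: card_restr_sets_Cons)
  then have count: "odd (card (restr_sets (a # y) k T)) \<longleftrightarrow>
      (T \<subseteq> S \<and> odd (half_binom N k (card T))) \<noteq>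
      (k \<noteq> 0 \<and> toggle a T \<subseteq> S \<and> odd (half_binom N (k - 1) (card (toggle a T))))"
    by (simp only: IH)
  obtain l where l: "card S + 2 * l = length y" using card_oddsupp[of y] by (auto simp: S_def)
  have "odd (card (restr_sets (a # y) k T)) \<longleftrightarrow>
      T \<subseteq> toggle a S \<and> odd (half_binom ((Suc (length y) - card (toggle a S)) div 2) k (card T))"
  proof (cases "a \<in> S")
    case aS: True
    then have "card S > 0" using finS by (auto simp: card_gt_0_iff)
    \<comment> \<open>The length grows and the support shrinks by one, so half the difference grows
      by one.\<close>
    then have N': "(Suc (length y) - card (toggle a S)) div 2 = Suc N"
      using aS l by (simp add: toggle_def N_def)
    show ?thesis
    proof (cases "T \<subseteq> S")
      case TS: True
      then have finT: "finite T" using finS finite_subset by blast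
      show ?thesis
      proof (cases "a \<in> T")
        case aT: True
        then obtain m where m: "card T = Suc m" using finT by (metis card_Suc_Diff1)
        then have "card (toggle a T) = m" using aT by (simp add: toggle_def)
        moreover have "toggle a T \<subseteq> S" using aT TS by (auto simp: toggle_def)
        moreover have "\<not> T \<subseteq> toggle a S" using aT aS by (auto simp: toggle_def)
        \<comment> \<open>For \<open>k > 0\<close> the two \<open>half_binom\<close> values in
          \<open>count\<close> are equal and cancel modulo 2; for \<open>k = 0\<close> neither term
          contributes.\<close>
        ultimately show ?thesis
          unfolding count using TS m by (cases k) (simp_all add: half_binom_Suc_Suc half_binom_0_Suc)
      next
        case aT: False
        then have "card (toggle a T) = Suc (card T)" "toggle a T \<subseteq> S" "T \<subseteq> toggle a S"
          using TS aS finT by (auto simp: toggle_def)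
        then show ?thesis using TS by (auto simp: count N' half_binom_Pascal)
      qed
    next
      case False
      then have "\<not> toggle a T \<subseteq> S" "\<not> T \<subseteq> toggle a S"
        using aS by (auto simp: toggle_def split: if_splits)
      with False show ?thesis by (simp add: count)
    qed
  next
    case aS: False
    then have N': "(Suc (length y) - card (toggle a S)) div 2 = N"
      using finS by (simp add: toggle_def N_def)
    show ?thesis
    proof (cases "a \<in> T")
      case aT: True
      \<comment> \<open>Modulo 2, only index sets containing the new position contribute.\<close>
      then have nTS: "\<not> T \<subseteq> S" using aS by blast
      have iff: "toggle a T \<subseteq> S \<longleftrightarrow> T \<subseteq> toggle a S"
        using aT aS by (auto simp: toggle_def)
      show ?thesis
      proof (cases "T \<subseteq> toggle a S")
        case True
        then have "finite T" using finS by (auto simp: toggle_def intro: finite_subset split: if_splits)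
        then obtain m where m: "card T = Suc m" using aT by (metis card_Suc_Diff1)
        then have "card (toggle a T) = m" using aT by (simp add: toggle_def)
        then show ?thesis
          unfolding count using True m nTS iff N' by (cases k) (simp_all add: half_binom_Suc_Suc half_binom_0_Suc)
      next
        case False
        then show ?thesis using nTS iff by (simp add: count)
      qed
    next
      case aT: False
      then have "\<not> toggle a T \<subseteq> S" "T \<subseteq> toggle a S \<longleftrightarrow> T \<subseteq> S"
        using aS by (auto simp: toggle_def)
      then show ?thesis by (simp add: count N')
    qed
  qed
  then show ?case by (simp add: S_def)
qed

section \<open>Binomial parities and the coefficients of the linear system\<close>

lemma even_sum_choose_mult_choose:
  fixes N t :: nat
  assumes "t < N"
  shows "even (\<Sum>j\<le>N. (j choose t) * (N choose j))"
proof -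
  have "(\<Sum>j\<le>N. (j choose t) * (N choose j)) = (\<Sum>j=t..N. (j choose t) * (N choose j))"
    by (rule sum.mono_neutral_right) (auto simp: not_le)
  \<comment> \<open>Trinomial revision frees one factor from \<open>j\<close> and leaves a full row
    of Pascal's triangle.\<close>
  also have "\<dots> = (\<Sum>j=t..N. (N choose t) * ((N - t) choose (j - t)))"
    by (rule sum.cong) (auto simp: choose_mult[symmetric] mult.commute)
  also have "\<dots> = (N choose t) * (\<Sum>j\<le>N - t. (N - t) choose j)"
    unfolding sum_distrib_left
    by (rule sum.reindex_bij_witness[of _ "\<lambda>j. j + t" "\<lambda>j. j - t"]) (use assms in auto)
  also have "\<dots> = (N choose t) * 2 ^ (N - t)"
    by (simp add: choose_row_sum)
  finally show ?thesis using assms by simp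
qed

lemma odd_sum_choose_mult_choose:
  fixes N t :: nat
  assumes "t < N"
  shows "odd (\<Sum>i<N. (i choose t) * (N choose Suc i))"
proof -
  from assms have "Suc t \<le> N" by simp
  then show ?thesis
  proof (induction N rule: dec_induct)
    case base
    have "(\<Sum>i<t. (i choose t) * (Suc t choose Suc i)) = 0"
      by (rule sum.neutral) simp
    then show ?case by (simp only: sum.lessThan_Suc binomial_n_n) simp
  next
    case (step N)
    have "(\<Sum>i<Suc N. (i choose t) * (Suc N choose Suc i)) =
        (\<Sum>i<Suc N. (i choose t) * (N choose i)) + (\<Sum>i<Suc N. (i choose t) * (N choose Suc i))"
      by (simp add: distrib_left sum.distrib)
    \<comment> \<open>The top summand contains \<open>N choose Suc N\<close>, which is 0.\<close>
    also have "(\<Sum>i<Suc N. (i choose t) * (N choose Suc i)) = (\<Sum>i<N. (i choose t) * (N choose Suc i))"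
      by simp
    finally show ?case
      using step even_sum_choose_mult_choose[of t N]
      by (simp add: lessThan_Suc_atMost del: sum.lessThan_Suc binomial_Suc_Suc)
  qed
qed

text \<open>Only the parity is meaningful: for \<open>T \<subseteq> S\<close> it is that of the
  multiplicity of \<open>\<phi> T\<close> in the equation at any tuple of length \<open>n\<close>
  with odd support \<open>S\<close>.\<close>

definition coeff :: "nat \<Rightarrow> nat \<Rightarrow> 'a set \<Rightarrow> 'a set \<Rightarrow> nat" where
  "coeff n t S T =
     (\<Sum>i = t + 1..n div 2. ((i - 1) choose t) * half_binom ((n - card S) div 2) (n - 2 * i) (card T))"

lemma odd_coeff_diagonal:
  assumes "card S + 2 * N = n" "t < N"
  shows "odd (coeff n t S S)"
proof -
  have N: "(n - card S) div 2 = N" "N \<le> n div 2" using assms by auto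
  \<comment> \<open>For \<open>i > N\<close> the size \<open>n - 2 * i\<close> is below
    \<open>card S\<close>.\<close>
  have "coeff n t S S = (\<Sum>i = t + 1..N. ((i - 1) choose t) * half_binom N (n - 2 * i) (card S))"
    unfolding coeff_def N(1)
    by (rule sum.mono_neutral_right) (use assms N in \<open>auto simp: half_binom_def\<close>)
  also have "\<dots> = (\<Sum>i = t + 1..N. ((i - 1) choose t) * (N choose i))"
  proof (rule sum.cong)
    fix i assume "i \<in> {t + 1..N}"
    then have "i \<le> N" by simp
    moreover from this have "n - 2 * i = card S + 2 * (N - i)" using assms by simp
    ultimately show "((i - 1) choose t) * half_binom N (n - 2 * i) (card S) = ((i - 1) choose t) * (N choose i)"
      by (simp add: half_binom_def binomial_symmetric[of i N])
  qed simp
  \<comment> \<open>The added terms vanish since \<open>i - 1 < t\<close>. Starting at 0 would be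
    wrong: \<open>0 - 1\<close> truncates to 0, so \<open>t = 0\<close> would gain a summand
    1.\<close>
  also have "\<dots> = (\<Sum>i = 1..N. ((i - 1) choose t) * (N choose i))"
    by (rule sum.mono_neutral_left) auto
  also have "\<dots> = (\<Sum>i<N. (i choose t) * (N choose Suc i))"
    by (rule sum.reindex_bij_witness[of _ Suc "\<lambda>i. i - 1"]) auto
  finally show ?thesis using odd_sum_choose_mult_choose[OF assms(2)] by simp
qed

text \<open>This keeps the triangular system inside \<open>Pow' n A\<close>: some
  \<open>half_binom\<close> term is nonzero, which fixes the parity of
  \<open>n - card T\<close>.\<close>

lemma odd_coeff_imp_in_Pow':
  assumes "odd (coeff n t S T)" "T \<subseteq> A"
  shows "T \<in> Pow' n A"
proof -
  from assms(1) obtain i where i: "i \<in> {t + 1..n div 2}"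
    and "half_binom ((n - card S) div 2) (n - 2 * i) (card T) \<noteq> 0"
    unfolding coeff_def by (metis (no_types, lifting) even_zero mult_0_right sum.neutral)
  then have "card T \<le> n - 2 * i" "even (n - 2 * i - card T)"
    by (auto simp: half_binom_def split: if_splits)
  then obtain j where "n - 2 * i = card T + 2 * j" by (metis evenE le_add_diff_inverse)
  then have "card T + 2 * (i + j) = n" using i by auto
  with assms(2) show ?thesis unfolding Pow'_def by blast
qed

section \<open>Rewriting the representation over a Boolean group\<close>

lemma nat_multiple_boolean:
  fixes b :: "'b::ab_group_add"
  assumes boolean: "\<And>b::'b. b + b = 0"
  shows "nat_multiple m b = (if odd m then b else 0)"
  by (induction m) (auto simp: nat_multiple_def boolean)

lemma nat_multiple_add: "nat_multiple (l + m) b = nat_multiple l b + nat_multiple m b"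
  by (induction m) (auto simp: nat_multiple_def ac_simps)

lemma nat_multiple_sum: "nat_multiple (\<Sum>i\<in>I. m i) b = (\<Sum>i\<in>I. nat_multiple (m i) b)"
  by (induction I rule: infinite_finite_induct) (auto simp: nat_multiple_add, auto simp: nat_multiple_def)

text \<open>Index sets are grouped by the odd support \<open>T\<close> they produce, then the sums
  over sizes and over \<open>T\<close> are exchanged. The result depends on \<open>x\<close> only
  through its length and odd support.\<close>

lemma representation_sum_eq:
  fixes \<phi> :: "'a set \<Rightarrow> 'b::ab_group_add"
  assumes boolean: "\<And>b::'b. b + b = 0"
  shows "(\<Sum>i = t + 1..length x div 2. \<Sum>I | I \<subseteq> {..<length x} \<and> card I = length x - 2 * i.
            nat_multiple ((i - 1) choose t) (\<phi> (oddsupp (nths x I)))) =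
         (\<Sum>T | T \<subseteq> oddsupp x \<and> odd (coeff (length x) t (oddsupp x) T). \<phi> T)"
proof -
  define n where "n = length x"
  define S where "S = oddsupp x"
  have bool: "nat_multiple m b = (if odd m then b else 0)" for m and b :: 'b
    by (rule nat_multiple_boolean[OF boolean])
  have inner: "(\<Sum>I | I \<subseteq> {..<n} \<and> card I = k. nat_multiple c (\<phi> (oddsupp (nths x I)))) =
      (\<Sum>T\<in>Pow S. nat_multiple (c * half_binom ((n - card S) div 2) k (card T)) (\<phi> T))" for k c
  proof -
    have "(\<Sum>I | I \<subseteq> {..<n} \<and> card I = k. nat_multiple c (\<phi> (oddsupp (nths x I)))) =
        (\<Sum>T\<in>Pow (set x). \<Sum>I | I \<in> {I. I \<subseteq> {..<n} \<and> card I = k} \<and> oddsupp (nths x I) = T.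
           nat_multiple c (\<phi> (oddsupp (nths x I))))"
      by (rule sum.group[symmetric]) (use oddsupp_nths_subset[of x] in auto)
    also have "\<dots> = (\<Sum>T\<in>Pow (set x). \<Sum>I\<in>restr_sets x k T. nat_multiple c (\<phi> T))"
      by (intro sum.cong) (auto simp: restr_sets_def n_def)
    also have "\<dots> = (\<Sum>T\<in>Pow (set x). nat_multiple (c * card (restr_sets x k T)) (\<phi> T))"
    proof (rule sum.cong)
      fix T
      have "nat_multiple (c * card (restr_sets x k T)) (\<phi> T) =
          nat_multiple (\<Sum>I\<in>restr_sets x k T. c) (\<phi> T)" by (simp add: mult.commute)
      also have "\<dots> = (\<Sum>I\<in>restr_sets x k T. nat_multiple c (\<phi> T))"
        by (rule nat_multiple_sum)
      finally show "(\<Sum>I\<in>restr_sets x k T. nat_multiple c (\<phi> T)) =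
          nat_multiple (c * card (restr_sets x k T)) (\<phi> T)" ..
    qed simp
    \<comment> \<open>For \<open>T\<close> not contained in \<open>S\<close> the count is even, and
      even multiples vanish.\<close>
    also have "\<dots> = (\<Sum>T\<in>Pow S. nat_multiple (c * card (restr_sets x k T)) (\<phi> T))"
      by (rule sum.mono_neutral_right)
        (use oddsupp_subset[of x] in \<open>auto simp: bool S_def odd_card_restr_sets\<close>)
    also have "\<dots> = (\<Sum>T\<in>Pow S. nat_multiple (c * half_binom ((n - card S) div 2) k (card T)) (\<phi> T))"
      by (rule sum.cong) (auto simp: bool odd_card_restr_sets S_def n_def)
    finally show ?thesis .
  qed
  have "(\<Sum>i = t + 1..n div 2. \<Sum>I | I \<subseteq> {..<n} \<and> card I = n - 2 * i.
            nat_multiple ((i - 1) choose t) (\<phi> (oddsupp (nths x I)))) =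
      (\<Sum>T\<in>Pow S. nat_multiple (coeff n t S T) (\<phi> T))"
    by (simp only: inner coeff_def nat_multiple_sum) (rule sum.swap)
  also have "\<dots> = (\<Sum>T | T \<in> Pow S \<and> odd (coeff n t S T). \<phi> T)"
    unfolding bool by (rule sum.inter_filter[symmetric]) (simp add: S_def)
  finally show ?thesis by (simp add: S_def n_def)
qed

section \<open>Solving the triangular system, and the theorem\<close>

lemma triangular_solution_exists:
  fixes \<psi> :: "'a set \<Rightarrow> 'b::ab_group_add"
  shows "\<exists>\<phi>. \<forall>S. finite S \<longrightarrow> \<phi> S + (\<Sum>T | T \<subset> S \<and> Q S T. \<phi> T) = \<psi> S"
proof -
  define H where "H = (\<lambda>g S. \<psi> S - (\<Sum>T | T \<subset> S \<and> Q S T. g T))"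
  define \<phi> where "\<phi> = wfrec finite_psubset H"
  have "\<phi> S = \<psi> S - (\<Sum>T | T \<subset> S \<and> Q S T. \<phi> T)" if "finite S" for S
  proof -
    \<comment> \<open>The recursion sees \<open>\<phi>\<close> cut to the proper subsets of the
      finite set \<open>S\<close>, which covers every \<open>T\<close> in the sum.\<close>
    have "\<phi> S = H (cut \<phi> finite_psubset S) S"
      by (rule def_wfrec) (simp_all add: \<phi>_def)
    also have "\<dots> = \<psi> S - (\<Sum>T | T \<subset> S \<and> Q S T. \<phi> T)"
      unfolding H_def
      by (intro arg_cong[where f = "\<lambda>s. \<psi> S - s"] sum.cong)
        (use that in \<open>auto simp: cut_def finite_psubset_def\<close>)
    finally show ?thesis .
  qed
  then show ?thesis by (intro exI[of _ \<phi>]) (metis diff_add_cancel)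
qed

theorem theorem4p1:
  fixes A :: "'a set"
    and f :: "'a list \<Rightarrow> 'b::{ab_group_add, finite}"
    and n t :: nat
  assumes "finite A"
    and boolean: "\<And>b::'b. b + b = 0"
    and "n \<ge> 1"
    and "int n - int (card A) = 2 * int t + 1"
  shows "(determined_by_oddsupp n A f \<longleftrightarrow> (\<exists>\<phi>. oddsupp_representation n t A f \<phi>)) \<and>
    (\<forall>\<phi> \<phi>'. oddsupp_representation n t A f \<phi> \<longrightarrow> oddsupp_representation n t A f \<phi>' \<longrightarrow>
       (\<forall>S\<in>Pow' n A. \<phi> S = \<phi>' S))"
proof -
  have n: "n = card A + 2 * t + 1" using assms(4) by linarith
  define Q where "Q S T \<longleftrightarrow> odd (coeff n t S T)" for S T :: "'a set"
  have rep: "oddsupp_representation n t A f \<phi> \<longleftrightarrow>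
      (\<forall>x\<in>tuples n A. f x = (\<Sum>T | T \<subseteq> oddsupp x \<and> Q (oddsupp x) T. \<phi> T))" for \<phi>
  proof -
    have "(\<Sum>i = t + 1..n div 2. \<Sum>I | I \<subseteq> {..<n} \<and> card I = n - 2 * i.
              nat_multiple ((i - 1) choose t) (\<phi> (oddsupp (nths x I)))) =
        (\<Sum>T | T \<subseteq> oddsupp x \<and> Q (oddsupp x) T. \<phi> T)" if "x \<in> tuples n A" for x
      using representation_sum_eq[OF boolean, where t = t and x = x and \<phi> = \<phi>] that by (simp add: tuples_def Q_def)
    then show ?thesis by (simp add: oddsupp_representation_def)
  qed
  have fin: "finite S" if "S \<in> Pow' n A" for S
    using that assms(1) finite_subset by (auto simp: Pow'_def)
  have split: "(\<Sum>T | T \<subseteq> S \<and> Q S T. \<phi> T) = \<phi> S + (\<Sum>T | T \<subset> S \<and> Q S T. \<phi> T)"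
    if S: "S \<in> Pow' n A" for S and \<phi> :: "'a set \<Rightarrow> 'b"
  proof -
    from S obtain N where N: "card S + 2 * N = n" and "S \<subseteq> A" by (auto simp: Pow'_def)
    then have "card S \<le> card A" using assms(1) by (simp add: card_mono)
    \<comment> \<open>Here \<open>2 * N = n - card S\<close> is at least
      \<open>n - card A = 2 * t + 1\<close>, so \<open>N\<close> exceeds \<open>t\<close>.\<close>
    then have "t < N" using N n by linarith
    then have "Q S S" using N by (simp add: Q_def odd_coeff_diagonal)
    then have "{T. T \<subseteq> S \<and> Q S T} = insert S {T. T \<subset> S \<and> Q S T}" by auto
    moreover have "finite {T. T \<subset> S \<and> Q S T}"
      by (rule finite_subset[of _ "Pow S"]) (use fin[OF S] in auto)
    ultimately show ?thesis by simp
  qed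
  have "\<exists>\<phi>. oddsupp_representation n t A f \<phi>" if "determined_by_oddsupp n A f"
  proof -
    from that obtain \<psi> where \<psi>: "\<And>x. x \<in> tuples n A \<Longrightarrow> f x = \<psi> (oddsupp x)"
      by (auto simp: determined_by_oddsupp_def)
    obtain \<phi> where "\<And>S. finite S \<Longrightarrow> \<phi> S + (\<Sum>T | T \<subset> S \<and> Q S T. \<phi> T) = \<psi> S"
      using triangular_solution_exists[of Q \<psi>] by blast
    then have "oddsupp_representation n t A f \<phi>"
      using \<psi> split[OF oddsupp_in_Pow'] by (simp add: rep)
    then show ?thesis by blast
  qed
  \<comment> \<open>The rewritten right-hand side is a function of \<open>oddsupp x\<close> and
    serves as the required map.\<close>
  moreover have "determined_by_oddsupp n A f" if "oddsupp_representation n t A f \<phi>" for \<phi>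
    using that unfolding rep determined_by_oddsupp_def
    by (intro exI[of _ "\<lambda>S. \<Sum>T | T \<subseteq> S \<and> Q S T. \<phi> T"])
  moreover have "\<phi> S = \<phi>' S"
    if "oddsupp_representation n t A f \<phi>" "oddsupp_representation n t A f \<phi>'" "S \<in> Pow' n A"
    for \<phi> \<phi>' S
    using fin[OF that(3)] that(3)
  proof (induction S rule: finite_psubset_induct)
    case (psubset S)
    \<comment> \<open>For empty \<open>A\<close> only \<open>S = {}\<close> could occur, but
      \<open>n = 2 * t + 1\<close> is odd. A letter for padding therefore exists, and
      \<open>S\<close> is the odd support of some tuple.\<close>
    have "A \<noteq> {}"
    proof
      assume "A = {}"
      then have "odd n" "S = {}" using n psubset.prems by (auto simp: Pow'_def)
      with psubset.prems show False by (auto simp: Pow'_def)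
    qed
    with assms(1) psubset.prems obtain x where x: "x \<in> tuples n A" "oddsupp x = S"
      using exists_tuple_with_oddsupp by blast
    \<comment> \<open>An odd coefficient puts \<open>T\<close> into \<open>Pow' n A\<close>, where
      the induction hypothesis applies.\<close>
    have "\<phi> T = \<phi>' T" if "T \<subset> S" "Q S T" for T
    proof -
      have "T \<subseteq> A" using that psubset.prems by (auto simp: Pow'_def)
      then show ?thesis
        using that psubset.IH odd_coeff_imp_in_Pow'[of n t S T A] by (simp add: Q_def)
    qed
    then have "(\<Sum>T | T \<subset> S \<and> Q S T. \<phi> T) = (\<Sum>T | T \<subset> S \<and> Q S T. \<phi>' T)"
      by (intro sum.cong) auto
    moreover have "f x = \<phi> S + (\<Sum>T | T \<subset> S \<and> Q S T. \<phi> T)"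
      "f x = \<phi>' S + (\<Sum>T | T \<subset> S \<and> Q S T. \<phi>' T)"
      using that(1,2) x split[OF psubset.prems] by (auto simp: rep)
    ultimately show ?case by simp
  qed
  ultimately show ?thesis by blast
qed

end
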